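(* Let $r,D\ge 1$ be integers. The following are equivalent: (1) $\Delta_{r,D}\ne 0$. (2) For all real numbers $b_1,\dots,b_{rD}$: if $\Phi_j(0)=\Phi_j\left(\frac1D\right)=\cdots=\Phi_j\left(\frac{D-1}{D}\right)=0$ for all $1\le j\le r$, then $b_1=b_2=\cdots=b_{rD}=0$.
   Context: The Bernoulli polynomials $B_n(x)$ are defined by $\frac{ze^{xz}}{e^z-1}=\sum_{n\ge 0}B_n(x)\frac{z^n}{n!}$. $\Delta_{r,D}$ is the determinant of the $rD\times rD$ matrix whose rows are indexed by $n=0,1,\dots,rD-1$ (in this order), and whose $(mD+v)$-th column ($0\le m\le r-1$, $1\le v\le D$) has in row $n$ the entry $D^{n+m}\,\frac{B_{n+m+1}(v/D)}{n+m+1}$. Given $b_1,\dots,b_{rD}$, for $1\le j\le r$ put $\Phi_j(x)=b_1\frac{B_j(x)}{j}+b_2\frac{B_{j+1}(x)}{j+1}+\cdots+b_{rD}\frac{B_{rD+j-1}(x)}{rD+j-1}$. *)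

theory Defs
  imports
    "Jordan_Normal_Form.Determinant"
    "HOL-Computational_Algebra.Formal_Power_Series"
begin

(* The series exp(z) - 1 has zero constant term; since z divides the numerator, the division of
   formal power series below is nevertheless exact, see bernpoly_generating_function. *)
definition bernpoly :: "nat \<Rightarrow> real \<Rightarrow> real" where
  "bernpoly n x = fact n * fps_nth (fps_X * fps_exp x / (fps_exp 1 - 1)) n"

lemma bernpoly_generating_function:
  "Abs_fps (\<lambda>n. bernpoly n x / fact n) * (fps_exp 1 - 1) = fps_X * fps_exp x"
proof -
  let ?f = "fps_X * fps_exp x :: real fps" and ?g = "fps_exp 1 - 1 :: real fps"
  have g1: "fps_nth ?g 1 = 1" by simp
  then have g_nz: "?g \<noteq> 0" by (metis fps_zero_nth zero_neq_one)
  have "subdegree ?g \<le> subdegree ?f"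
  proof -
    have "subdegree ?g \<le> 1" using g1 by (intro subdegree_leI) simp
    moreover have "fps_nth (fps_exp x :: real fps) 0 \<noteq> 0" by simp
    then have "fps_exp x \<noteq> (0 :: real fps)" by (metis fps_zero_nth)
    then have "1 \<le> subdegree ?f" by (intro subdegree_geI) auto
    ultimately show ?thesis by linarith
  qed
  then have "?g dvd ?f" using g_nz by (simp add: fps_dvd_iff)
  moreover have "Abs_fps (\<lambda>n. bernpoly n x / fact n) = ?f / ?g"
    by (simp add: fps_eq_iff bernpoly_def)
  ultimately show ?thesis by simp
qed

(* Rows and columns are counted from 0 here, so that the column with index c corresponds to
   the pair (m, v) with c + 1 = m * D + v, 1 \<le> v \<le> D. *)
definition bern_mat :: "nat \<Rightarrow> nat \<Rightarrow> real mat" where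
  "bern_mat r D = mat (r * D) (r * D) (\<lambda>(n, c).
     let m = c div D; v = c mod D + 1
     in real D ^ (n + m) * (bernpoly (n + m + 1) (real v / real D) / real (n + m + 1)))"

definition bern_det :: "nat \<Rightarrow> nat \<Rightarrow> real" where
  "bern_det r D = det (bern_mat r D)"

definition Phi :: "nat \<Rightarrow> nat \<Rightarrow> (nat \<Rightarrow> real) \<Rightarrow> nat \<Rightarrow> real \<Rightarrow> real" where
  "Phi r D b j x = (\<Sum>i = 1..r * D. b i * (bernpoly (i + j - 1) x / real (i + j - 1)))"

end

theory Submission
  imports Defs
begin

text \<open>
  A left kernel vector of the matrix, rescaled by powers of \<open>D\<close>, is a coefficient vector \<open>b\<close> for
  which every \<open>\<Phi>\<^sub>j\<close> vanishes at \<open>1/D, \<dots>, D/D\<close>. The second condition uses the nodes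
  \<open>0, \<dots>, (D - 1)/D\<close> instead, and \<open>\<Phi>\<^sub>1(0)\<close> and \<open>\<Phi>\<^sub>1(1)\<close> differ. The reflection formula
  \<open>B\<^sub>n(1 - x) = (-1)\<^sup>n B\<^sub>n(x)\<close> exchanges the two sets of nodes at the cost of
  alternating the signs of \<open>b\<close>.
\<close>

text \<open>Substitute \<open>-z\<close> for \<open>z\<close> in the generating function.
  Multiplying by \<open>exp z\<close> turns \<open>exp (-z) - 1\<close> into
  \<open>-(exp z - 1)\<close> and \<open>exp (-x z)\<close> into \<open>exp ((1 - x) z)\<close>, so
  the substituted series satisfies the equation that characterizes the series at
  \<open>1 - x\<close>.\<close>

lemma bernpoly_reflect: "bernpoly n (1 - x) = (-1) ^ n * bernpoly n x"
proof -
  let ?F = "\<lambda>x. Abs_fps (\<lambda>n. bernpoly n x / fact n)"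
  let ?g = "fps_exp 1 - 1 :: real fps"
  \<comment> \<open>The series \<open>-X\<close> is written as a constant times \<open>fps_X\<close>
    to fit the rules for linear substitution.\<close>
  let ?L = "fps_const (-1) * fps_X :: real fps"
  let ?G = "fps_compose (?F x) ?L"
  have "fps_compose (?F x * ?g) ?L = fps_compose (fps_X * fps_exp x) ?L"
    by (simp only: bernpoly_generating_function)
  then have "?G * (fps_exp (-1) - 1) = - fps_X * fps_exp (- x)"
    by (simp add: fps_compose_mult_distrib fps_compose_sub_distrib fps_exp_compose_linear
        flip: fps_const_neg)
  then have "?G * (fps_exp (-1) - 1) * fps_exp 1 = - fps_X * fps_exp (- x) * fps_exp 1"
    by simp
  moreover have "(fps_exp (-1) - 1) * fps_exp 1 = - ?g"
    by (simp add: algebra_simps flip: fps_exp_add_mult)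
  moreover have "fps_exp (- x) * fps_exp 1 = fps_exp (1 - x)"
    by (simp flip: fps_exp_add_mult)
  ultimately have "?G * - ?g = - fps_X * fps_exp (1 - x)"
    by (simp only: mult.assoc)
  then have "?G * ?g = fps_X * fps_exp (1 - x)"
    by (simp only: mult_minus_right mult_minus_left neg_equal_iff_equal)
  then have "?G * ?g = ?F (1 - x) * ?g"
    by (simp only: bernpoly_generating_function)
  \<comment> \<open>The constant term of \<open>?g\<close> is 0, so \<open>?g\<close> is not a unit;
    being nonzero, it can still be cancelled in the integral domain of power series.\<close>
  moreover have "fps_nth ?g 1 \<noteq> 0"
    by simp
  then have "?g \<noteq> 0"
    by (metis fps_zero_nth)
  ultimately have "?G = ?F (1 - x)"
    by simp
  then have "fps_nth ?G n = bernpoly n (1 - x) / fact n"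
    by simp
  then show ?thesis
    by (simp only: fps_nth_compose_linear) simp
qed

text \<open>The sign \<open>(-1) ^ i\<close> of the coefficient and the sign
  \<open>(-1) ^ (i + j - 1)\<close> from reflection multiply to \<open>(-1) ^ (j - 1)\<close>, which
  does not depend on \<open>i\<close> and leaves the sum.\<close>

lemma Phi_alternate:
  assumes "j \<ge> 1"
  shows "Phi r D (\<lambda>i. (-1) ^ i * b i) j (1 - x) = (-1) ^ (j - 1) * Phi r D b j x"
proof -
  have "(-1) ^ i * b i * (bernpoly (i + j - 1) (1 - x) / real (i + j - 1)) =
      (-1) ^ (j - 1) * (b i * (bernpoly (i + j - 1) x / real (i + j - 1)))" for i
  proof -
    have "i + j - 1 = i + (j - 1)"
      using assms by simp
    then have "(-1) ^ i * (-1) ^ (i + j - 1) = ((-1) ^ (j - 1) :: real)"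
      by (simp add: power_add flip: mult.assoc power_mult_distrib)
    then show ?thesis
      by (simp add: bernpoly_reflect ac_simps)
  qed
  then show ?thesis
    unfolding Phi_def sum_distrib_left by (rule sum.cong[OF refl])
qed

text \<open>In the entry's factor \<open>D ^ (n + m)\<close>, the part \<open>D ^ n\<close> cancels
  against the scaling of the coefficient and \<open>D ^ m\<close> is common to the column. Row
  \<open>n\<close>, counted from 0, carries the coefficient with index \<open>Suc n\<close>.\<close>

lemma bern_mat_column_sum:
  assumes "c < r * D"
  shows "(\<Sum>n<r * D. bern_mat r D $$ (n, c) * (b (Suc n) / real D ^ n)) =
    real D ^ (c div D) * Phi r D b (c div D + 1) (real (c mod D + 1) / real D)"
proof -
  have "D > 0"
    using assms by (cases D) auto
  then have "bern_mat r D $$ (n, c) * (b (Suc n) / real D ^ n) = real D ^ (c div D) *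
      (b (Suc n) * (bernpoly (Suc n + (c div D + 1) - 1) (real (c mod D + 1) / real D) /
        real (Suc n + (c div D + 1) - 1)))" if "n < r * D" for n
    using that assms by (simp add: bern_mat_def Let_def power_add field_simps)
  then show ?thesis
    unfolding Phi_def sum_distrib_left
    by (intro sum.reindex_bij_witness[of _ "\<lambda>i. i - 1" Suc]) auto
qed

text \<open>The coefficients weight rows, so the kernel of the transpose is what matters. Since
  \<open>D > 0\<close>, the rescaling by \<open>D ^ n\<close> is invertible and preserves being
  nonzero.\<close>

lemma bern_det_nonzero_iff:
  assumes "D \<ge> 1"
  shows "bern_det r D \<noteq> 0 \<longleftrightarrow>
    (\<forall>b. (\<forall>j\<in>{1..r}. \<forall>v\<in>{1..D}. Phi r D b j (real v / real D) = 0) \<longrightarrow>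
      (\<forall>i\<in>{1..r * D}. b i = 0))"
    (is "_ \<longleftrightarrow> (\<forall>b. ?Z b \<longrightarrow> ?T b)")
proof -
  let ?N = "r * D" and ?A = "bern_mat r D"
  have A: "?A \<in> carrier_mat ?N ?N"
    by (simp add: bern_mat_def)
  have Z_iff: "?Z b \<longleftrightarrow> (\<forall>c<?N. (\<Sum>n<?N. ?A $$ (n, c) * (b (Suc n) / real D ^ n)) = 0)" for b
  proof
    assume Z: "?Z b"
    show "\<forall>c<?N. (\<Sum>n<?N. ?A $$ (n, c) * (b (Suc n) / real D ^ n)) = 0"
    proof (intro allI impI)
      fix c assume c: "c < ?N"
      then have "c div D < r"
        by (simp add: less_mult_imp_div_less)
      moreover have "c mod D < D"
        using assms by simp
      ultimately have "Phi r D b (c div D + 1) (real (c mod D + 1) / real D) = 0"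
        using Z by (intro Z[rule_format]) auto
      then show "(\<Sum>n<?N. ?A $$ (n, c) * (b (Suc n) / real D ^ n)) = 0"
        using bern_mat_column_sum[OF c] by simp
    qed
  next
    assume *: "\<forall>c<?N. (\<Sum>n<?N. ?A $$ (n, c) * (b (Suc n) / real D ^ n)) = 0"
    show "?Z b"
    proof (intro ballI)
      fix j v assume j: "j \<in> {1..r}" and v: "v \<in> {1..D}"
      obtain w where w: "v = Suc w" "w < D"
        using v by (cases v) auto
      \<comment> \<open>This inverts the column numbering: \<open>j - 1\<close> is the block and
        \<open>w = v - 1\<close> the position inside it.\<close>
      define c where "c = (j - 1) * D + w"
      have "c < (j - 1) * D + D"
        using w by (simp add: c_def)
      also have "\<dots> = j * D"
        using j by (cases j) auto
      also have "\<dots> \<le> ?N"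
        using j by simp
      finally have c: "c < ?N" .
      have "c div D + 1 = j" "c mod D + 1 = v"
        using j w by (auto simp: c_def)
      then have "real D ^ (c div D) * Phi r D b j (real v / real D) = 0"
        using * c bern_mat_column_sum[OF c, of b] by simp
      then show "Phi r D b j (real v / real D) = 0"
        using assms by simp
    qed
  qed
  have "bern_det r D = 0 \<longleftrightarrow>
      (\<exists>v. v \<in> carrier_vec ?N \<and> v \<noteq> 0\<^sub>v ?N \<and> transpose_mat ?A *\<^sub>v v = 0\<^sub>v ?N)"
    using det_0_iff_vec_prod_zero[of "transpose_mat ?A" ?N] A
    by (simp add: bern_det_def det_transpose[OF A])
  also have "\<dots> \<longleftrightarrow> (\<exists>b. ?Z b \<and> \<not> ?T b)"
  proof
    assume "\<exists>v. v \<in> carrier_vec ?N \<and> v \<noteq> 0\<^sub>v ?N \<and> transpose_mat ?A *\<^sub>v v = 0\<^sub>v ?N"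
    then obtain v where v: "v \<in> carrier_vec ?N" "v \<noteq> 0\<^sub>v ?N" "transpose_mat ?A *\<^sub>v v = 0\<^sub>v ?N"
      by blast
    define b where "b i = real D ^ (i - 1) * v $ (i - 1)" for i
    have "(\<Sum>n<?N. ?A $$ (n, c) * (b (Suc n) / real D ^ n)) = 0" if "c < ?N" for c
    proof -
      have "(\<Sum>n<?N. ?A $$ (n, c) * (b (Suc n) / real D ^ n)) = (transpose_mat ?A *\<^sub>v v) $ c"
        using A v(1) that assms by (auto simp: b_def scalar_prod_def lessThan_atLeast0)
      then show ?thesis
        using v(3) that by simp
    qed
    then have "?Z b"
      unfolding Z_iff by blast
    moreover obtain n where "n < ?N" "v $ n \<noteq> 0"
      using v(1,2) by (metis eq_vecI carrier_vecD index_zero_vec)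
    then have "\<not> ?T b"
      using assms by (auto simp: b_def intro!: bexI[of _ "Suc n"])
    ultimately show "\<exists>b. ?Z b \<and> \<not> ?T b"
      by blast
  next
    assume "\<exists>b. ?Z b \<and> \<not> ?T b"
    then obtain b i where b: "?Z b" and i: "i \<in> {1..?N}" "b i \<noteq> 0"
      by blast
    define v where "v = vec ?N (\<lambda>n. b (Suc n) / real D ^ n)"
    have "v $ (i - 1) \<noteq> 0" "i - 1 < ?N"
      using i assms by (auto simp: v_def)
    then have "v \<noteq> 0\<^sub>v ?N"
      by (metis index_zero_vec(1))
    moreover have "transpose_mat ?A *\<^sub>v v = 0\<^sub>v ?N"
    proof (rule eq_vecI)
      fix c assume "c < dim_vec (0\<^sub>v ?N :: real vec)"
      then show "(transpose_mat ?A *\<^sub>v v) $ c = 0\<^sub>v ?N $ c"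
        using b[unfolded Z_iff] A by (auto simp: v_def scalar_prod_def lessThan_atLeast0)
    qed (use A in simp)
    ultimately show "\<exists>v. v \<in> carrier_vec ?N \<and> v \<noteq> 0\<^sub>v ?N \<and> transpose_mat ?A *\<^sub>v v = 0\<^sub>v ?N"
      by (intro exI[of _ v]) (simp add: v_def)
  qed
  finally show ?thesis
    by blast
qed

theorem proposition2p3:
  fixes r D :: nat
  assumes "r \<ge> 1" and "D \<ge> 1"
  shows "bern_det r D \<noteq> 0 \<longleftrightarrow>
    (\<forall>b :: nat \<Rightarrow> real.
      (\<forall>j\<in>{1..r}. \<forall>k\<in>{0..D - 1}. Phi r D b j (real k / real D) = 0) \<longrightarrow>
      (\<forall>i\<in>{1..r * D}. b i = 0))"
proof -
  let ?lo = "\<lambda>b. \<forall>j\<in>{1..r}. \<forall>k\<in>{0..D - 1}. Phi r D b j (real k / real D) = 0"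
  let ?hi = "\<lambda>b. \<forall>j\<in>{1..r}. \<forall>v\<in>{1..D}. Phi r D b j (real v / real D) = 0"
  let ?alt = "\<lambda>b i. (-1 :: real) ^ i * b i"
  have node: "real (D - k) / real D = 1 - real k / real D" if "k \<le> D" for k
    using that assms(2) by (simp add: of_nat_diff field_simps)
  \<comment> \<open>Only zeros are compared, so the sign \<open>(-1) ^ (j - 1)\<close> is harmless.
    The map from \<open>k\<close> to \<open>D - k\<close> exchanges \<open>{0..D - 1}\<close> and
    \<open>{1..D}\<close>.\<close>
  have alt: "Phi r D (?alt b) j (real (D - k) / real D) = 0 \<longleftrightarrow> Phi r D b j (real k / real D) = 0"
    if "j \<in> {1..r}" "k \<le> D" for b j k
    using that by (simp add: node Phi_alternate del: of_nat_diff)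
  have lo_hi: "?hi (?alt b)" if "?lo b" for b
  proof (intro ballI)
    fix j v assume "j \<in> {1..r}" "v \<in> {1..D}"
    then show "Phi r D (?alt b) j (real v / real D) = 0"
      using that alt[of j "D - v" b] by (auto simp del: of_nat_diff)
  qed
  have hi_lo: "?lo (?alt b)" if "?hi b" for b
  proof (intro ballI)
    fix j k assume "j \<in> {1..r}" "k \<in> {0..D - 1}"
    then show "Phi r D (?alt b) j (real k / real D) = 0"
      using that alt[of j "D - k" b] assms(2) by (auto simp del: of_nat_diff)
  qed
  have vanish_alt: "(\<forall>i\<in>{1..r * D}. ?alt b i = 0) \<longleftrightarrow> (\<forall>i\<in>{1..r * D}. b i = 0)" for b
    by simp
  show ?thesis
    unfolding bern_det_nonzero_iff[OF assms(2)]
    \<comment> \<open>In each direction the hypothesis is applied to the alternated coefficients,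
      which vanish exactly when the original ones do.\<close>
    by (intro iffI allI impI; (drule lo_hi | drule hi_lo); subst vanish_alt[symmetric]; blast)
qed

end
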